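(* Let $X_1,X_2,\ldots$ and $Y_1,Y_2,\ldots$ be two independent sequences of i.i.d. unit exponential random variables, and for each $n$ let $X_{(1)}\le\cdots\le X_{(n)}$ and $Y_{(1)}\le\cdots\le Y_{(n)}$ be the order statistics of $X_1,\ldots,X_n$ and $Y_1,\ldots,Y_n$ respectively. Let $0<\alpha_n<\beta_n<1$ be sequences such that $$\frac{\min\{\alpha_n,\,1-\beta_n\}}{\sqrt{(\log n)/n}}\to\infty\quad(n\to\infty),$$ and let $\Lambda_m=\Lambda_m(n)=\{i\in\mathbb{N}:\alpha_n n<i<\beta_n n\}$, assumed nonempty. Then $$q_{n,\Lambda_m}:=\max_{i\in\Lambda_m}\frac{X_{(i)}}{Y_{(i)}}\ \xrightarrow{P}\ 1\quad\text{as }n\to\infty.$$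
   Context: A unit exponential random variable has distribution function $1-e^{-x}$, $x\ge 0$. $\xrightarrow{P}$ denotes convergence in probability. The subscript $m$ in $\Lambda_m$ stands for "middle" and is not an index. *)

theory Defs
  imports "HOL-Probability.Probability"
begin

text \<open>
  Sequences are indexed from 1: the sample of size \<open>n\<close> consists of \<open>x 1, \<dots>, x n\<close>, and the
  order statistics are \<open>order_stat x n 1 \<le> \<dots> \<le> order_stat x n n\<close>. The value of
  \<open>order_stat x n i\<close> is meaningful only for \<open>1 \<le> i \<le> n\<close>.
\<close>
definition order_stat :: "(nat \<Rightarrow> real) \<Rightarrow> nat \<Rightarrow> nat \<Rightarrow> real" where
  "order_stat x n i = sort (map x [1..<Suc n]) ! (i - 1)"

definition Lambda_m :: "(nat \<Rightarrow> real) \<Rightarrow> (nat \<Rightarrow> real) \<Rightarrow> nat \<Rightarrow> nat set" where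
  "Lambda_m \<alpha> \<beta> n = {i. \<alpha> n * real n < real i \<and> real i < \<beta> n * real n}"

text \<open>
  The division \<open>_ / 0 = 0\<close> matters only on the null event that some \<open>Y\<close> vanishes.
\<close>
definition max_ratio ::
  "(nat \<Rightarrow> 'a \<Rightarrow> real) \<Rightarrow> (nat \<Rightarrow> 'a \<Rightarrow> real) \<Rightarrow> nat \<Rightarrow> nat set \<Rightarrow> 'a \<Rightarrow> real" where
  "max_ratio X Y n \<Lambda> \<omega> =
    Max ((\<lambda>i. order_stat (\<lambda>j. X j \<omega>) n i / order_stat (\<lambda>j. Y j \<omega>) n i) ` \<Lambda>)"

text \<open>
  Measurability is part of the definition because \<open>measure M\<close> is 0 on non-measurable sets.
\<close>
definition tendsto_in_prob ::
  "'a measure \<Rightarrow> (nat \<Rightarrow> 'a \<Rightarrow> real) \<Rightarrow> ('a \<Rightarrow> real) \<Rightarrow> bool" where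
  "tendsto_in_prob M Z L \<longleftrightarrow>
    (\<forall>n. Z n \<in> borel_measurable M) \<and> L \<in> borel_measurable M \<and>
    (\<forall>\<epsilon>>0. (\<lambda>n. measure M {\<omega> \<in> space M. \<bar>Z n \<omega> - L \<omega>\<bar> > \<epsilon>}) \<longlonglongrightarrow> 0)"

end

theory Submission
  imports Defs
begin

text \<open>
  Write \<open>u = i / n\<close> and \<open>d = sqrt (ln n / n)\<close>. The distribution function
  \<open>F x = 1 - exp (- x)\<close> carries the sample to a uniform one, so \<open>F X\<^bsub>(i)\<^esub>\<close> should be close
  to \<open>u\<close>. Quantitatively, \<open>X\<^bsub>(i)\<^esub> \<le> t\<close> says that at least \<open>i\<close> of the \<open>n\<close> independent events
  \<open>X\<^sub>j \<le> t\<close> occur, and Hoeffding's inequality for this count, taken at the two quantiles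
  \<open>t\<close> with \<open>F t = u \<plusminus> d\<close>, shows that \<open>\<bar>F X\<^bsub>(i)\<^esub> - u\<bar> > d\<close> has probability at most
  \<open>2 exp (- 2 n d\<^sup>2) = 2 / n\<^sup>2\<close> (\<open>exponential_order_stat_concentration\<close>). The choice of \<open>d\<close>
  makes this small enough to be added over the at most \<open>n\<close> relevant \<open>i\<close> and both samples: outside an
  event of probability at most \<open>4 / n\<close>, both order statistics have \<open>F\<close>-values within \<open>d\<close>
  of \<open>u\<close>, simultaneously for all \<open>i\<close> in \<open>\<Lambda>\<^sub>m\<close>.

  It remains to compare two numbers \<open>x\<close>, \<open>y\<close> whose \<open>F\<close>-values are within \<open>d\<close> of \<open>u\<close>.
  The growth hypothesis ensures that, for each \<open>h > 0\<close>, all large \<open>n\<close> and all these \<open>i\<close>, \<open>d\<close> is at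
  most \<open>h\<close> times both \<open>u\<close> and \<open>1 - u\<close>. The quantile function \<open>- ln (1 - v)\<close> is of size at least
  \<open>v\<close> and has slope \<open>1 / (1 - v)\<close>, so the relative difference of \<open>x\<close> and \<open>y\<close> is of order
  \<open>d / (u (1 - u))\<close>, hence of order \<open>h\<close> (\<open>exponential_quantile_ratio\<close>). As the ratios are
  uniformly close to 1, so is their maximum.
\<close>

section \<open>Order statistics and counts\<close>

lemma sorted_nth_le_iff:
  fixes xs :: "'a::linorder list"
  assumes "sorted xs" "k < length xs"
  shows "xs ! k \<le> t \<longleftrightarrow> k < length (filter (\<lambda>a. a \<le> t) xs)"
  using assms
proof (induction xs arbitrary: k)
  case (Cons a xs)
  have *: "filter (\<lambda>a. a \<le> t) xs = []" if "\<not> a \<le> t"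
    using Cons.prems(1) that by (force simp: filter_empty_conv)
  show ?case
  proof (cases k)
    case 0 then show ?thesis using * by auto
  next
    case (Suc m)
    have "xs ! m > t" if "\<not> a \<le> t"
      using that Cons.prems Suc by (force dest: nth_mem)
    then show ?thesis using Cons Suc * by auto
  qed
qed simp

text \<open>
  This equivalence replaces the sorted sample by a count, which, unlike the order statistic,
  is a sum of independent variables and visibly measurable.
\<close>
lemma order_stat_le_iff:
  assumes "1 \<le> i" "i \<le> n"
  shows "order_stat x n i \<le> t \<longleftrightarrow> i \<le> card {j \<in> {1..n}. x j \<le> t}"
proof -
  have "length (filter (\<lambda>a. a \<le> t) (sort (map x [1..<Suc n])))
      = size (filter_mset (\<lambda>a. a \<le> t) (mset (map x [1..<Suc n])))"
    by (simp only: mset_filter mset_sort flip: size_mset)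
  also have "\<dots> = length (filter (\<lambda>j. x j \<le> t) [1..<Suc n])"
    by (simp only: filter_map length_map comp_def size_mset flip: mset_filter)
  also have "\<dots> = card (set (filter (\<lambda>j. x j \<le> t) [1..<Suc n]))"
    by (rule distinct_card [symmetric]) simp
  also have "set (filter (\<lambda>j. x j \<le> t) [1..<Suc n]) = {j \<in> {1..n}. x j \<le> t}"
    by auto
  finally show ?thesis
    using assms sorted_nth_le_iff [of "sort (map x [1..<Suc n])" "i - 1" t]
    by (auto simp: order_stat_def)
qed

lemma card_eq_sum_indicator:
  fixes x :: "nat \<Rightarrow> real"
  shows "real (card {j \<in> {1..n}. x j \<le> t}) = (\<Sum>j\<in>{1..n}. indicator {..t} (x j))"
proof -
  have "(\<Sum>j\<in>{1..n}. indicator {..t} (x j) :: real) = (\<Sum>j\<in>{1..n}. if x j \<le> t then 1 else 0)"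
    by (intro sum.cong) auto
  also have "\<dots> = (\<Sum>j\<in>{j \<in> {1..n}. x j \<le> t}. 1)"
    by (rule sum.inter_filter[symmetric]) simp
  also have "\<dots> = real (card {j \<in> {1..n}. x j \<le> t})"
    by simp
  finally show ?thesis ..
qed

lemma borel_measurable_order_stat:
  assumes "\<And>j. 1 \<le> j \<Longrightarrow> X j \<in> borel_measurable M" "1 \<le> i" "i \<le> n"
  shows "(\<lambda>\<omega>. order_stat (\<lambda>j. X j \<omega>) n i) \<in> borel_measurable M"
proof (rule borel_measurableI_le)
  fix t
  have [measurable]: "X j \<in> borel_measurable M" if "j \<in> {1..n}" for j
    using assms that by auto
  have "{\<omega> \<in> space M. order_stat (\<lambda>j. X j \<omega>) n i \<le> t}
      = {\<omega> \<in> space M. real i \<le> (\<Sum>j\<in>{1..n}. indicator {..t} (X j \<omega>))}"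
    unfolding card_eq_sum_indicator[symmetric] using assms by (simp add: order_stat_le_iff)
  also have "\<dots> \<in> sets M" by measurable
  finally show "{\<omega> \<in> space M. order_stat (\<lambda>j. X j \<omega>) n i \<le> t} \<in> sets M" .
qed

section \<open>Stability of exponential quantiles\<close>

text \<open>
  With \<open>F x = 1 - exp (- x)\<close>, both \<open>x\<close> and \<open>y\<close> are quantiles at levels within \<open>d\<close> of \<open>u\<close>.
  On the levels concerned the derivative \<open>exp (- x)\<close> of \<open>F\<close> is at least \<open>(1 - h) (1 - u)\<close>, so
  \<open>x\<close> and \<open>y\<close> differ by at most \<open>2 d / ((1 - h) (1 - u))\<close>, while \<open>y \<ge> F y \<ge> (1 - h) u\<close>.
  The two bounds on \<open>d\<close> imply \<open>d \<le> 2 h u (1 - u)\<close>, which gives the relative error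
  \<open>4 h / (1 - h)\<^sup>2 \<le> 16 h\<close>.
\<close>
lemma exponential_quantile_ratio:
  fixes x y u d h :: real
  assumes u: "0 < u" "u < 1" and h: "0 \<le> h" "h \<le> 1 / 2"
    and d: "d \<le> h * u" "d \<le> h * (1 - u)"
    and x: "\<bar>1 - exp (- x) - u\<bar> \<le> d"
    and y: "\<bar>1 - exp (- y) - u\<bar> \<le> d"
  shows "\<bar>x / y - 1\<bar> \<le> 16 * h"
proof -
  define m where "m = (1 - h) * (1 - u)"
  have m: "m > 0" using u h by (auto simp: m_def)
  have ge: "m \<le> exp (- z)" if "\<bar>1 - exp (- z) - u\<bar> \<le> d" for z
    using that d by (auto simp: m_def algebra_simps)
  have dist: "a - b \<le> 2 * d / m" if "\<bar>1 - exp (- a) - u\<bar> \<le> d" "\<bar>1 - exp (- b) - u\<bar> \<le> d" for a b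
  proof -
    have "m * (a - b) \<le> 2 * d"
    proof (cases "a \<ge> b")
      case True
      have "m * (a - b) \<le> exp (- a) * (a - b)"
        using ge[OF that(1)] True by (intro mult_right_mono) auto
      also have "\<dots> \<le> exp (- a) * (exp (a - b) - 1)"
      proof (intro mult_left_mono)
        show "a - b \<le> exp (a - b) - 1" using exp_ge_add_one_self[of "a - b"] by linarith
      qed simp
      also have "\<dots> = exp (- b) - exp (- a)"
        by (simp add: algebra_simps flip: exp_add)
      also have "\<dots> \<le> 2 * d" using that by auto
      finally show ?thesis .
    next
      case False
      then have "m * (a - b) \<le> 0" using m by (simp add: mult_le_0_iff)
      then show ?thesis using that by linarith
    qed
    then show ?thesis using m by (simp add: field_simps)
  qed
  have "(1 - h) * u \<le> 1 - exp (- y)" using y d by (auto simp: algebra_simps)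
  also have "\<dots> \<le> y" using exp_ge_add_one_self[of "- y"] by simp
  finally have yl: "(1 - h) * u \<le> y" .
  moreover have "0 < (1 - h) * u" using u h by auto
  ultimately have y0: "y > 0" by linarith
  have "\<bar>x - y\<bar> \<le> 2 * d / m" using dist[OF x y] dist[OF y x] by linarith
  also have "\<dots> \<le> 16 * h * ((1 - h) * u)"
  proof -
    \<comment> \<open>The larger of \<open>u\<close> and \<open>1 - u\<close> is at least a half, so the bound on \<open>d\<close> by \<open>h\<close> times
      the smaller one loses at most a factor 2.\<close>
    have "d \<le> h * (2 * u * (1 - u))"
    proof (cases "u \<le> 1 / 2")
      case True
      have "h * u * (1 - 2 * u) \<ge> 0" using True h u by auto
      then show ?thesis using d by (simp add: algebra_simps)
    next
      case False
      have "h * (1 - u) * (2 * u - 1) \<ge> 0" using False h u by auto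
      then show ?thesis using d by (simp add: algebra_simps)
    qed
    moreover have "1 / 4 \<le> (1 - h) * (1 - h)"
      using mult_mono[of "1/2" "1 - h" "1/2" "1 - h"] h by auto
    then have "h * u * (1 - u) * (1 / 4) \<le> h * u * (1 - u) * ((1 - h) * (1 - h))"
      using h u by (intro mult_left_mono) auto
    ultimately have "2 * d \<le> 16 * h * ((1 - h) * u) * m"
      by (simp add: m_def algebra_simps)
    then show ?thesis using m by (simp add: pos_divide_le_eq)
  qed
  also have "\<dots> \<le> 16 * h * y" using yl h by (intro mult_left_mono) auto
  finally have "\<bar>x - y\<bar> \<le> 16 * h * y" .
  moreover have "\<bar>x / y - 1\<bar> = \<bar>x - y\<bar> / y" using y0 by (simp add: field_simps abs_if)
  ultimately show ?thesis using y0 by (simp add: pos_divide_le_eq)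
qed

section \<open>Concentration of exponential order statistics\<close>

context prob_space
begin

lemma empirical_count_Hoeffding:
  fixes X :: "nat \<Rightarrow> 'a \<Rightarrow> real"
  assumes indep: "indep_vars (\<lambda>_. borel) X {1..n}" and n: "n \<ge> 1"
    and p: "\<And>j. j \<in> {1..n} \<Longrightarrow> \<P>(\<omega> in M. X j \<omega> \<le> t) = p" and d: "d \<ge> 0"
  shows "\<P>(\<omega> in M. real (card {j \<in> {1..n}. X j \<omega> \<le> t}) \<ge> real n * (p + d)) \<le> exp (- 2 * real n * d\<^sup>2)"
    and "\<P>(\<omega> in M. real (card {j \<in> {1..n}. X j \<omega> \<le> t}) \<le> real n * (p - d)) \<le> exp (- 2 * real n * d\<^sup>2)"
proof -
  have [measurable]: "random_variable borel (X j)" if "j \<in> {1..n}" for j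
    using indep that unfolding indep_vars_def by blast
  interpret H: Hoeffding_ineq M "{1..n}" "\<lambda>j \<omega>. indicator {..t} (X j \<omega>)" "\<lambda>_. 0" "\<lambda>_. 1" "real n * p"
  proof unfold_locales
    show "indep_vars (\<lambda>_. borel) (\<lambda>j \<omega>. indicator {..t} (X j \<omega>) :: real) {1..n}"
      by (rule indep_vars_compose2[OF indep]) auto
    have "expectation (\<lambda>\<omega>. indicator {..t} (X j \<omega>) :: real) = p" if j: "j \<in> {1..n}" for j
    proof -
      have "expectation (\<lambda>\<omega>. indicator {..t} (X j \<omega>) :: real)
          = expectation (indicator {\<omega> \<in> space M. X j \<omega> \<le> t})"
        by (intro Bochner_Integration.integral_cong) (auto simp: indicator_def)
      also have "\<dots> = p" using j p by simp
      finally show ?thesis .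
    qed
    then show "real n * p \<equiv> \<Sum>j\<in>{1..n}. expectation (\<lambda>\<omega>. indicator {..t} (X j \<omega>))"
      by (simp add: atomize_eq)
  qed (auto simp: indicator_def)
  have e: "- 2 * (real n * d)\<^sup>2 / (\<Sum>j\<in>{1..n}. (1 - 0)\<^sup>2) = - 2 * real n * d\<^sup>2"
    using n by (simp add: power2_eq_square)
  show "\<P>(\<omega> in M. real (card {j \<in> {1..n}. X j \<omega> \<le> t}) \<ge> real n * (p + d)) \<le> exp (- 2 * real n * d\<^sup>2)"
    using H.Hoeffding_ineq_ge[of "real n * d"] n d
    unfolding e card_eq_sum_indicator by (simp add: distrib_left)
  show "\<P>(\<omega> in M. real (card {j \<in> {1..n}. X j \<omega> \<le> t}) \<le> real n * (p - d)) \<le> exp (- 2 * real n * d\<^sup>2)"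
    using H.Hoeffding_ineq_le[of "real n * d"] n d
    unfolding e card_eq_sum_indicator by (simp add: right_diff_distrib)
qed

text \<open>
  Let \<open>q\<close> be the quantile function, \<open>u = i / n\<close>. If the level of the \<open>i\<close>-th order statistic
  is at most \<open>u - d\<close>, then at least \<open>i = n u\<close> sample points lie below \<open>q (u - d)\<close>, which exceeds
  the expected number by \<open>n d\<close> or more; if it exceeds \<open>u + d\<close>, then fewer than \<open>n u\<close> points lie below
  \<open>q (u + d)\<close>, which falls short of the expected number by more than \<open>n d\<close>. The range of \<open>d\<close> guarantees that both
  quantiles exist.
\<close>
lemma exponential_order_stat_concentration:
  fixes X :: "nat \<Rightarrow> 'a \<Rightarrow> real"
  assumes indep: "indep_vars (\<lambda>_. borel) X {1..n}"
    and dist: "\<And>j. j \<in> {1..n} \<Longrightarrow> distributed M lborel (X j) (exponential_density 1)"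
    and i: "1 \<le> i" "i \<le> n" and d: "0 \<le> d" "d \<le> real i / real n" "real i / real n + d < 1"
  shows "\<P>(\<omega> in M. \<bar>1 - exp (- order_stat (\<lambda>j. X j \<omega>) n i) - real i / real n\<bar> > d)
           \<le> 2 * exp (- 2 * real n * d\<^sup>2)"
proof -
  define u where "u = real i / real n"
  have [measurable]: "random_variable borel (X j)" if "j \<in> {1..n}" for j
    using indep that unfolding indep_vars_def by blast
  have meas: "{\<omega> \<in> space M. P (real (card {j \<in> {1..n}. X j \<omega> \<le> t}))} \<in> events"
    if [measurable]: "Measurable.pred borel P" for t P
    unfolding card_eq_sum_indicator by measurable
  define q where "q v = - ln (1 - v)" for v :: real
  have cdf: "\<P>(\<omega> in M. X j \<omega> \<le> q v) = v" if "j \<in> {1..n}" "0 \<le> v" "v < 1" for j v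
    using exponential_distributedD_le[OF dist[OF that(1)], of "q v"] that by (simp add: q_def)
  have q: "1 - exp (- x) \<le> v \<longleftrightarrow> x \<le> q v" if "v < 1" for x v
  proof -
    have "1 - exp (- x) \<le> v \<longleftrightarrow> exp (ln (1 - v)) \<le> exp (- x)" using that by auto
    also have "\<dots> \<longleftrightarrow> x \<le> q v" by (auto simp: q_def simp del: exp_ln)
    finally show ?thesis .
  qed
  have nu: "real n * u = real i" using i by (simp add: u_def)
  let ?N = "\<lambda>\<omega> v. real (card {j \<in> {1..n}. X j \<omega> \<le> q v})"
  let ?lo = "{\<omega> \<in> space M. ?N \<omega> (u - d) \<ge> real n * (u - d + d)}"
  let ?hi = "{\<omega> \<in> space M. ?N \<omega> (u + d) \<le> real n * (u + d - d)}"
  have n: "n \<ge> 1" and v: "0 \<le> u - d" "u - d < 1" "0 \<le> u + d" "u + d < 1"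
    using i d by (auto simp: u_def)
  have "{\<omega> \<in> space M. \<bar>1 - exp (- order_stat (\<lambda>j. X j \<omega>) n i) - u\<bar> > d} \<subseteq> ?lo \<union> ?hi"
  proof
    fix \<omega> assume *: "\<omega> \<in> {\<omega> \<in> space M. \<bar>1 - exp (- order_stat (\<lambda>j. X j \<omega>) n i) - u\<bar> > d}"
    let ?x = "order_stat (\<lambda>j. X j \<omega>) n i"
    consider "1 - exp (- ?x) \<le> u - d" | "\<not> 1 - exp (- ?x) \<le> u + d" using * by force
    then show "\<omega> \<in> ?lo \<union> ?hi"
      using * i v by cases (simp_all add: q order_stat_le_iff nu)
  qed
  then have "\<P>(\<omega> in M. \<bar>1 - exp (- order_stat (\<lambda>j. X j \<omega>) n i) - u\<bar> > d) \<le> prob (?lo \<union> ?hi)"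
    by (intro finite_measure_mono) (auto intro!: sets.Un meas)
  also have "\<dots> \<le> prob ?lo + prob ?hi"
    by (intro measure_Un_le meas) auto
  also have "\<dots> \<le> exp (- 2 * real n * d\<^sup>2) + exp (- 2 * real n * d\<^sup>2)"
    using v cdf d by (intro add_mono empirical_count_Hoeffding[OF indep n]) auto
  finally show ?thesis by (simp add: u_def)
qed

end

section \<open>The maximal ratio\<close>

lemma Lambda_m_subset:
  assumes "n \<ge> 1" "0 < \<alpha> n" "\<beta> n < 1"
  shows "Lambda_m \<alpha> \<beta> n \<subseteq> {1..n}"
proof
  fix i assume "i \<in> Lambda_m \<alpha> \<beta> n"
  then have "\<alpha> n * real n < real i" "real i < \<beta> n * real n" by (auto simp: Lambda_m_def)
  moreover have "0 < \<alpha> n * real n" "\<beta> n * real n \<le> real n" using assms by auto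
  ultimately show "i \<in> {1..n}" by auto
qed

lemma borel_measurable_max_ratio:
  fixes X Y :: "nat \<Rightarrow> 'a \<Rightarrow> real"
  assumes "\<And>j. 1 \<le> j \<Longrightarrow> X j \<in> borel_measurable M" "\<And>j. 1 \<le> j \<Longrightarrow> Y j \<in> borel_measurable M"
    and S: "S \<subseteq> {1..n}"
  shows "max_ratio X Y n S \<in> borel_measurable M"
proof -
  have fin: "finite S" using S finite_subset by blast
  have [measurable]: "(\<lambda>\<omega>. order_stat (\<lambda>j. X j \<omega>) n i) \<in> borel_measurable M"
    "(\<lambda>\<omega>. order_stat (\<lambda>j. Y j \<omega>) n i) \<in> borel_measurable M" if "i \<in> S" for i
    using assms that by (auto intro!: borel_measurable_order_stat)
  show ?thesis
    unfolding max_ratio_def using fin by (intro borel_measurable_Max) auto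
qed

lemma abs_Max_diff_le:
  fixes f :: "'b \<Rightarrow> real"
  assumes "finite S" "S \<noteq> {}" "\<And>i. i \<in> S \<Longrightarrow> \<bar>f i - c\<bar> \<le> e"
  shows "\<bar>Max (f ` S) - c\<bar> \<le> e"
proof -
  have "Max (f ` S) \<in> f ` S" using assms by (intro Max_in) auto
  then show ?thesis using assms(3) by auto
qed

theorem theorem2p2:
  fixes M :: "'a measure" and X Y :: "nat \<Rightarrow> 'a \<Rightarrow> real" and \<alpha> \<beta> :: "nat \<Rightarrow> real"
  assumes "prob_space M"
    and "prob_space.indep_vars M (\<lambda>_. borel) X {1..}"
    and "\<And>i. i \<ge> 1 \<Longrightarrow> distributed M lborel (X i) (exponential_density 1)"
    and "prob_space.indep_vars M (\<lambda>_. borel) Y {1..}"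
    and "\<And>i. i \<ge> 1 \<Longrightarrow> distributed M lborel (Y i) (exponential_density 1)"
    and "prob_space.indep_var M
           (PiM {1..} (\<lambda>_. borel)) (\<lambda>\<omega>. \<lambda>i\<in>{1..}. X i \<omega>)
           (PiM {1..} (\<lambda>_. borel)) (\<lambda>\<omega>. \<lambda>i\<in>{1..}. Y i \<omega>)"
    and "\<And>n. n \<ge> 1 \<Longrightarrow> 0 < \<alpha> n \<and> \<alpha> n < \<beta> n \<and> \<beta> n < 1"
    and "filterlim (\<lambda>n. min (\<alpha> n) (1 - \<beta> n) / sqrt (ln (real n) / real n)) at_top sequentially"
    and "eventually (\<lambda>n. Lambda_m \<alpha> \<beta> n \<noteq> {}) sequentially"
  shows "tendsto_in_prob M (\<lambda>n. max_ratio X Y n (Lambda_m \<alpha> \<beta> n)) (\<lambda>_. 1)"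
proof -
  interpret prob_space M by fact
  have measX: "random_variable borel (X j)" and measY: "random_variable borel (Y j)" if "1 \<le> j" for j
    using assms(2,4) that unfolding indep_vars_def by auto
  \<comment> \<open>For \<open>n = 0\<close> the index set is empty, whatever \<open>\<alpha> 0\<close> and \<open>\<beta> 0\<close> are.\<close>
  have sub: "Lambda_m \<alpha> \<beta> n \<subseteq> {1..n}" for n
  proof (cases "n = 0")
    case False
    then show ?thesis using assms(7)[of n] by (intro Lambda_m_subset) auto
  qed (auto simp: Lambda_m_def)
  have meas: "max_ratio X Y n (Lambda_m \<alpha> \<beta> n) \<in> borel_measurable M" for n
    using measX measY sub by (intro borel_measurable_max_ratio) auto
  have "(\<lambda>n. prob {\<omega> \<in> space M. \<bar>max_ratio X Y n (Lambda_m \<alpha> \<beta> n) \<omega> - 1\<bar> > \<epsilon>}) \<longlonglongrightarrow> 0"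
    if eps: "\<epsilon> > 0" for \<epsilon>
  proof -
    \<comment> \<open>Both constants come from the ratio bound \<open>16 * h\<close>, which holds for \<open>h \<le> 1 / 2\<close>.\<close>
    define h where "h = min (1 / 2) (\<epsilon> / 16)"
    have h: "0 < h" "h \<le> 1 / 2" "16 * h \<le> \<epsilon>" using eps by (auto simp: h_def)
    have bound: "prob {\<omega> \<in> space M. \<bar>max_ratio X Y n (Lambda_m \<alpha> \<beta> n) \<omega> - 1\<bar> > \<epsilon>} \<le> 4 / real n"
      if n: "n \<ge> 2" and ne: "Lambda_m \<alpha> \<beta> n \<noteq> {}"
        and big: "1 / h \<le> min (\<alpha> n) (1 - \<beta> n) / sqrt (ln (real n) / real n)" for n
    proof -
      define L where "L = Lambda_m \<alpha> \<beta> n"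
      \<comment> \<open>The deviation at which the Hoeffding bound \<open>exp (- 2 * n * d\<^sup>2)\<close> is \<open>1 / n\<^sup>2\<close>,
        small enough for a union bound over \<open>n\<close> indices.\<close>
      define d where "d = sqrt (ln (real n) / real n)"
      have d: "d > 0" using n by (simp add: d_def)
      have d_le: "d \<le> h * \<alpha> n" "d \<le> h * (1 - \<beta> n)"
        using big h d by (auto simp: field_simps simp flip: d_def)
      have L: "finite L" "L \<subseteq> {1..n}" "L \<noteq> {}"
        using sub[of n] ne by (auto simp: L_def intro: finite_subset)
      have u: "\<alpha> n < real i / real n" "real i / real n < \<beta> n" "0 < \<alpha> n" "\<beta> n < 1"
        if "i \<in> L" for i
        using that n assms(7)[of n] by (auto simp: L_def Lambda_m_def field_simps)
      have du: "d \<le> h * (real i / real n)" "d \<le> h * (1 - real i / real n)" if "i \<in> L" for i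
      proof -
        have "\<alpha> n \<le> real i / real n" "1 - \<beta> n \<le> 1 - real i / real n" "0 \<le> h"
          using u[OF that] h by linarith+
        then have "h * \<alpha> n \<le> h * (real i / real n)" "h * (1 - \<beta> n) \<le> h * (1 - real i / real n)"
          by (blast intro: mult_left_mono)+
        then show "d \<le> h * (real i / real n)" "d \<le> h * (1 - real i / real n)"
          using d_le by linarith+
      qed
      have e: "exp (- 2 * real n * d\<^sup>2) = 1 / (real n)\<^sup>2"
      proof -
        have "- 2 * real n * d\<^sup>2 = - (2 * ln (real n))" using n by (simp add: d_def)
        then have "exp (- 2 * real n * d\<^sup>2) = inverse (exp (ln (real n)) ^ 2)"
          by (simp only: exp_minus exp_double)
        then show ?thesis using n by (simp add: inverse_eq_divide)
      qed
      define dev where "dev Z i = {\<omega> \<in> space M.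
          \<bar>1 - exp (- order_stat (\<lambda>j. Z j \<omega>) n i) - real i / real n\<bar> > d}"
        for Z :: "nat \<Rightarrow> 'a \<Rightarrow> real" and i
      have dev: "dev Z i \<in> events" "prob (dev Z i) \<le> 2 / (real n)\<^sup>2"
        if Z: "indep_vars (\<lambda>_. borel) Z {1..}"
          "\<And>j. j \<ge> 1 \<Longrightarrow> distributed M lborel (Z j) (exponential_density 1)" and i: "i \<in> L"
        for Z i
      proof -
        have [measurable]: "(\<lambda>\<omega>. order_stat (\<lambda>j. Z j \<omega>) n i) \<in> borel_measurable M"
          using Z(1) L i unfolding indep_vars_def by (intro borel_measurable_order_stat) auto
        show "dev Z i \<in> events" unfolding dev_def by measurable
        define v where "v = real i / real n"
        have v: "0 < v" "v < 1" "d \<le> h * v" "d \<le> h * (1 - v)"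
          using du[OF i] u[OF i] unfolding v_def by linarith+
        have "h * v \<le> 1 * v" "h * (1 - v) \<le> (1 / 2) * (1 - v)"
          using h v(1,2) by (auto intro!: mult_right_mono)
        then have "d \<le> 1 * v" "d \<le> (1 / 2) * (1 - v)"
          using v(3,4) by (blast intro: order_trans)+
        then have "d \<le> v" "v + d < 1" using v(2) by simp_all
        then have "d \<le> real i / real n" "real i / real n + d < 1" by (simp_all add: v_def)
        moreover have "indep_vars (\<lambda>_. borel) Z {1..n}"
          by (rule indep_vars_subset[OF Z(1)]) auto
        ultimately show "prob (dev Z i) \<le> 2 / (real n)\<^sup>2"
          using exponential_order_stat_concentration[of Z n i d] Z(2) L i d
          unfolding e dev_def by auto
      qed
      note devX = dev[OF assms(2) assms(3)] and devY = dev[OF assms(4) assms(5)]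
      have "{\<omega> \<in> space M. \<bar>max_ratio X Y n L \<omega> - 1\<bar> > \<epsilon>} \<subseteq> (\<Union>i\<in>L. dev X i \<union> dev Y i)"
      proof (rule subsetI, rule ccontr)
        fix \<omega> assume 1: "\<omega> \<in> {\<omega> \<in> space M. \<bar>max_ratio X Y n L \<omega> - 1\<bar> > \<epsilon>}"
          and 2: "\<omega> \<notin> (\<Union>i\<in>L. dev X i \<union> dev Y i)"
        have "\<bar>order_stat (\<lambda>j. X j \<omega>) n i / order_stat (\<lambda>j. Y j \<omega>) n i - 1\<bar> \<le> 16 * h"
          if i: "i \<in> L" for i
          using 1 2 i u[OF i] h du[OF i]
          by (intro exponential_quantile_ratio[where u = "real i / real n" and d = d])
             (auto simp: dev_def not_less)
        then have "\<bar>max_ratio X Y n L \<omega> - 1\<bar> \<le> 16 * h"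
          unfolding max_ratio_def using L by (intro abs_Max_diff_le)
        then show False using 1 h by auto
      qed
      then have "prob {\<omega> \<in> space M. \<bar>max_ratio X Y n L \<omega> - 1\<bar> > \<epsilon>}
          \<le> prob (\<Union>i\<in>L. dev X i \<union> dev Y i)"
        using L devX(1) devY(1) by (intro finite_measure_mono sets.finite_UN sets.Un) auto
      also have "\<dots> \<le> (\<Sum>i\<in>L. prob (dev X i \<union> dev Y i))"
        using L devX(1) devY(1) by (intro finite_measure_subadditive_finite) auto
      also have "\<dots> \<le> (\<Sum>i\<in>L. 4 / (real n)\<^sup>2)"
      proof (rule sum_mono)
        fix i assume i: "i \<in> L"
        have "prob (dev X i \<union> dev Y i) \<le> prob (dev X i) + prob (dev Y i)"
          using i by (intro measure_Un_le devX devY)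
        then show "prob (dev X i \<union> dev Y i) \<le> 4 / (real n)\<^sup>2"
          using devX(2)[OF _ i] devY(2)[OF _ i] by simp
      qed
      also have "\<dots> \<le> real n * (4 / (real n)\<^sup>2)"
        using card_mono[OF _ L(2)] by (simp add: divide_right_mono)
      also have "\<dots> = 4 / real n" by (simp add: power2_eq_square)
      finally show ?thesis by (simp add: L_def)
    qed
    have "eventually (\<lambda>n. 1 / h \<le> min (\<alpha> n) (1 - \<beta> n) / sqrt (ln (real n) / real n)) sequentially"
      using assms(8) by (simp add: filterlim_at_top)
    then have "eventually (\<lambda>n. prob {\<omega> \<in> space M. \<bar>max_ratio X Y n (Lambda_m \<alpha> \<beta> n) \<omega> - 1\<bar> > \<epsilon>}
        \<le> 4 / real n) sequentially"
      using assms(9) eventually_ge_at_top[of 2] by eventually_elim (rule bound)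
    then show ?thesis
      by (intro tendsto_sandwich[OF _ _ tendsto_const lim_const_over_n[of 4]]) auto
  qed
  then show ?thesis using meas by (auto simp: tendsto_in_prob_def)
qed

end
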